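(* Let $n\ge 2$ and let $f\in S_n$ be a cyclic permutation (an $n$-cycle). Then the characteristic sequence $m_1'\le m_2'\le\cdots\le m_{n-1}'$ of $f$ satisfies $m_i'\le i$ for all $i=1,2,\ldots,n-1$.
   Context: A permutation $f\in S_n$ of $\{1,\ldots,n\}$ is called cyclic if it can be written as a single cycle $(i_1 i_2\ldots i_n)$ of length $n$, meaning $f:i_1\to i_2\to\cdots\to i_n\to i_1$. For a finite nonempty set $A\subseteq\{1,\ldots,n\}$ put $\mathrm{conv}f(A)=\{\min f(A),\min f(A)+1,\ldots,\max f(A)\}$, the set of all integers between the minimum and the maximum of $f(A)$. This defines a map from nonempty subsets of $\{1,\ldots,n\}$ to such subsets, and $(\mathrm{conv}f)^m$ denotes its $m$-th iterate. For $i=1,\ldots,n-1$ let $A_i=\{i,i+1\}$ and define the characteristic number $m_i=\min\{m\ge 1 : (\mathrm{conv}f)^m(A_i)\supseteq A_i\}$ (read as $+\infty$ if there is no such $m$). The characteristic sequence $m_1'\le m_2'\le\cdots\le m_{n-1}'$ of $f$ is the nondecreasing rearrangement of $m_1,\ldots,m_{n-1}$. *)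

theory Defs
  imports "HOL-Combinatorics.Cycles" "HOL-Library.Extended_Nat"
begin

text \<open>
  Permutations of \<open>{1..n}\<close> are functions on \<^typ>\<open>nat\<close> that fix every point outside \<open>{1..n}\<close>
  (\<open>permutes\<close>). The list \<open>cs\<close> below contains each element of \<open>{1..n}\<close> exactly once;
  \<open>cycle_of_list cs\<close> maps each entry to the next one, and the last to the first.
\<close>

definition cyclic_permutation :: "nat \<Rightarrow> (nat \<Rightarrow> nat) \<Rightarrow> bool" where
  "cyclic_permutation n f \<longleftrightarrow>
     f permutes {1..n} \<and> (\<exists>cs. distinct cs \<and> set cs = {1..n} \<and> f = cycle_of_list cs)"

text \<open>Only meaningful for finite nonempty \<open>A\<close>; this class of sets is preserved.\<close>

definition conv_map :: "(nat \<Rightarrow> nat) \<Rightarrow> nat set \<Rightarrow> nat set" where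
  "conv_map f A = {Min (f ` A)..Max (f ` A)}"

text \<open>The infimum of the empty set of extended naturals is \<open>\<infinity>\<close>; otherwise it is the minimum.\<close>

definition char_number :: "(nat \<Rightarrow> nat) \<Rightarrow> nat \<Rightarrow> enat" where
  "char_number f i =
     Inf {enat m | m. 1 \<le> m \<and> {i, i + 1} \<subseteq> (conv_map f ^^ m) {i, i + 1}}"

text \<open>
  The list has length \<open>n - 1\<close>. List positions start at 0, so the \<open>i\<close>-th term of the characteristic
  sequence is the list entry at position \<open>i - 1\<close>.
\<close>

definition char_sequence :: "nat \<Rightarrow> (nat \<Rightarrow> nat) \<Rightarrow> enat list" where
  "char_sequence n f = sort (map (char_number f) [1..<n])"

end

theory Submission
  imports Defs "Jordan_Normal_Form.Char_Poly"
begin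

text \<open>
  Orient the intervals \<open>A\<^sub>i\<close> as chains \<open>v\<^bsub>i+1\<^esub> - v\<^sub>i\<close>. The action of \<open>f\<close> on them is a signed version
  of the covering relation \<open>A\<^sub>j \<subseteq> conv f (A\<^sub>i)\<close>, and it is the restriction of the permutation
  representation of an \<open>n\<close>-cycle to the vectors with coordinate sum \<open>0\<close>. Its characteristic polynomial
  is therefore \<open>(x\<^sup>n - 1) / (x - 1)\<close>, all of whose coefficients are nonzero. So for each \<open>k\<close> some term of
  the Leibniz expansion contributes to the coefficient of \<open>x\<^bsup>n-1-k\<^esup>\<close>; it provides disjoint closed walks
  of length at most \<open>k\<close> in the covering relation that pass through at least \<open>k\<close> of the intervals.
\<close>

section \<open>Characteristic polynomials and Leibniz terms\<close>

text \<open>Since \<open>U\<close> has constant entries, it commutes with the scalar matrix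
  \<open>?X\<close> and hence intertwines the characteristic matrices too. Taking determinants and
  cancelling \<open>det ?U\<close> in the domain of polynomials avoids inverting \<open>U\<close>
  over the integers.\<close>

lemma char_poly_intertwine:
  fixes A B U :: "'a :: idom mat"
  assumes A: "A \<in> carrier_mat n n" and B: "B \<in> carrier_mat n n" and U: "U \<in> carrier_mat n n"
    and eq: "U * A = B * U" and det: "det U \<noteq> 0"
  shows "char_poly A = char_poly B"
proof -
  let ?U = "map_mat (\<lambda>a. [:a:]) U"
  let ?m = "map_mat (\<lambda>a. [:-a:])"
  let ?X = "[:0, 1:] \<cdot>\<^sub>m 1\<^sub>m n :: 'a poly mat"
  have const: "(\<Sum>i\<in>S. [:g i:]) = [:\<Sum>i\<in>S. g i:]" for g :: "nat \<Rightarrow> 'a" and S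
    by (induction S rule: infinite_finite_induct) auto
  have "?U * ?m A = ?m (U * A)"
    using U A by (intro eq_matI) (auto simp: scalar_prod_def sum_negf const mult.commute)
  also have "\<dots> = ?m B * ?U"
    unfolding eq using U B by (intro eq_matI) (auto simp: scalar_prod_def sum_negf const mult.commute)
  finally have c: "?U * ?m A = ?m B * ?U" .
  have "?U * ?X = ?X * ?U"
    using U by (simp add: mult_smult_distrib[of _ n n _ n] mult_smult_assoc_mat[of _ n n _ n])
  then have "?U * char_poly_matrix A = char_poly_matrix B * ?U"
    using A B U c by (simp add: char_poly_matrix_def mult_add_distrib_mat[of _ n n _ n]
        add_mult_distrib_mat[of _ n n _ _ n])
  then have "det (?U * char_poly_matrix A) = det (char_poly_matrix B * ?U)"
    by simp
  then have "det ?U * char_poly A = char_poly B * det ?U"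
    using A B U by (simp add: det_mult[of _ n] char_poly_def)
  moreover have "det ?U \<noteq> 0"
  proof -
    interpret h: comm_ring_hom "\<lambda>a :: 'a. [:a:]" by standard (auto simp: one_pCons)
    show ?thesis using det by simp
  qed
  ultimately show ?thesis by simp
qed

text \<open>A Leibniz term survives only if \<open>p i\<close> is \<open>i\<close> or
  \<open>h i\<close> for every index. The points moved by such a \<open>p\<close> form an
  \<open>h\<close>-invariant set, which by \<open>trans\<close> is empty or everything, so only
  \<open>id\<close> and \<open>h\<close> contribute. The sign of \<open>c\<close> is left open
  here.\<close>

lemma char_poly_cyclic_permutation_matrix:
  fixes h :: "nat \<Rightarrow> nat"
  assumes h: "h permutes {0..<n}" and n: "n \<ge> 2"
    and trans: "\<And>A. A \<subseteq> {0..<n} \<Longrightarrow> A \<noteq> {} \<Longrightarrow> h ` A \<subseteq> A \<Longrightarrow> A = {0..<n}"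
  shows "\<exists>c. char_poly (mat n n (\<lambda>(i, j). if h i = j then 1 else 0) :: int mat) = monom 1 n + [:c:]"
proof -
  define P where "P = (mat n n (\<lambda>(i, j). if h i = j then 1 else 0) :: int mat)"
  define t where "t p = (\<Prod>i = 0..<n. char_poly_matrix P $$ (i, p i))" for p
  have P: "P \<in> carrier_mat n n" by (simp add: P_def)
  have no_fix: "h i \<noteq> i" if "i < n" for i
  proof
    assume "h i = i"
    then have "{i} = {0..<n}" using trans[of "{i}"] that by auto
    then have "card {i} = card {0..<n}" by simp
    then show False using n by simp
  qed
  have entry: "char_poly_matrix P $$ (i, j) = (if i = j then [:0, 1:] else if h i = j then -1 else 0)"
    if "i < n" "j < n" for i j
    using that no_fix by (auto simp: char_poly_matrix_def P_def one_pCons)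
  have zero: "t p = 0" if p: "p permutes {0..<n}" and "p \<noteq> id" "p \<noteq> h" for p
  proof (rule ccontr)
    assume nz: "t p \<noteq> 0"
    have lt: "p i < n" if "i < n" for i
      using permutes_in_image[OF p, of i] that by simp
    have step: "p i = h i" if "i < n" "p i \<noteq> i" for i
    proof (rule ccontr)
      assume "p i \<noteq> h i"
      then have "char_poly_matrix P $$ (i, p i) = 0" using entry[of i "p i"] lt that by auto
      then show False using nz that by (auto simp: t_def)
    qed
    define C where "C = {i \<in> {0..<n}. p i \<noteq> i}"
    have "C \<noteq> {}"
    proof
      assume "C = {}"
      then have "p i = i" for i using permutes_not_in[OF p, of i] by (auto simp: C_def)
      then show False using \<open>p \<noteq> id\<close> by auto
    qed
    moreover have "h ` C \<subseteq> C"
    proof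
      fix j assume "j \<in> h ` C"
      then obtain i where i: "i < n" "p i \<noteq> i" "j = p i" using step by (auto simp: C_def)
      then show "j \<in> C" using lt[OF i(1)] permutes_inj[OF p] by (auto simp: C_def dest: injD)
    qed
    ultimately have "C = {0..<n}" by (intro trans) (auto simp: C_def)
    then have "i \<in> C" if "i < n" for i using that by simp
    then have "p i = h i" if "i < n" for i using step[OF that] that by (simp add: C_def)
    then have "p i = h i" for i
      using permutes_not_in[OF p, of i] permutes_not_in[OF h, of i] by (cases "i < n") auto
    then show False using \<open>p \<noteq> h\<close> by auto
  qed
  have "id \<noteq> h" using no_fix[of 0] n by (metis id_apply less_le_trans zero_less_numeral)
  have "char_poly P = (\<Sum>p\<in>{p. p permutes {0..<n}}. signof p * t p)"
    unfolding char_poly_def t_def by (rule det_def') (simp add: P)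
  also have "\<dots> = (\<Sum>p\<in>{id, h}. signof p * t p)"
    using h zero permutes_id by (intro sum.mono_neutral_right) (auto simp: finite_permutations)
  also have "\<dots> = t id + signof h * t h"
    using \<open>id \<noteq> h\<close> by simp
  also have "t id = monom 1 n"
    using entry by (simp add: t_def monom_altdef)
  also have "t h = (\<Prod>i = 0..<n. -1)"
    unfolding t_def using permutes_in_image[OF h] no_fix
    by (intro prod.cong) (auto simp: entry dest: sym)
  also have "\<dots> = [:(-1) ^ n:]"
    by (induction n) (auto simp: one_pCons)
  also have "signof h * [:(-1) ^ n:] = [:signof h * (-1) ^ n :: int:]"
    by (cases h rule: sign_cases) simp_all
  finally show ?thesis unfolding P_def by blast
qed

text \<open>The witness \<open>p\<close> comes from a Leibniz term with nonzero coefficient in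
  degree \<open>m - k\<close>. The degree of that term limits the number of moved points; the power
  of x dividing it limits the number of zero entries.\<close>

lemma char_poly_coeff_nonzero_obtains_permutation:
  fixes A :: "'a :: idom mat"
  assumes A: "A \<in> carrier_mat m m" and k: "k \<le> m" and nz: "coeff (char_poly A) (m - k) \<noteq> 0"
  obtains p where "p permutes {0..<m}" "card {i. p i \<noteq> i} \<le> k"
    "\<And>i. p i \<noteq> i \<Longrightarrow> A $$ (i, p i) \<noteq> 0" "k \<le> card {i \<in> {0..<m}. A $$ (i, p i) \<noteq> 0}"
proof -
  define t where "t p = (\<Prod>i = 0..<m. char_poly_matrix A $$ (i, p i))" for p
  have "char_poly A = (\<Sum>p\<in>{p. p permutes {0..<m}}. signof p * t p)"
    unfolding char_poly_def t_def by (rule det_def') (simp add: A)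
  then have "(\<Sum>p\<in>{p. p permutes {0..<m}}. coeff (signof p * t p) (m - k)) \<noteq> 0"
    using nz by (simp add: coeff_sum)
  then obtain p where p: "p permutes {0..<m}" and "coeff (signof p * t p) (m - k) \<noteq> 0"
    by (rule sum.not_neutral_contains_not_neutral) auto
  then have c: "coeff (t p) (m - k) \<noteq> 0"
    by (cases p rule: sign_cases) auto
  then have "t p \<noteq> 0" by auto
  have lt: "p i < m" if "i < m" for i
    using permutes_in_image[OF p, of i] that by simp
  have entry: "char_poly_matrix A $$ (i, p i) =
      (if p i = i then [:- A $$ (i, i), 1:] else [:- A $$ (i, p i):])" if "i < m" for i
    using that lt[OF that] A by (auto simp: char_poly_matrix_def)
  have moved: "p i \<noteq> i \<Longrightarrow> i < m" for i
    using permutes_not_in[OF p, of i] by fastforce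
  have supp: "A $$ (i, p i) \<noteq> 0" if "p i \<noteq> i" for i
  proof
    assume "A $$ (i, p i) = 0"
    then have "char_poly_matrix A $$ (i, p i) = 0" using entry[OF moved] that by simp
    then show False using \<open>t p \<noteq> 0\<close> moved[OF that] by (auto simp: t_def)
  qed
  let ?N = "{i. p i \<noteq> i}"
  let ?Z = "{i \<in> {0..<m}. A $$ (i, p i) = 0}"
  have N: "?N \<subseteq> {0..<m}" using moved by auto
  \<comment> \<open>Fixed points give linear factors and moved points give constants, so at least
    \<open>m - k\<close> points are fixed.\<close>
  have "m - k \<le> degree (t p)" using c by (rule le_degree)
  also have "\<dots> \<le> (\<Sum>i = 0..<m. degree (char_poly_matrix A $$ (i, p i)))"
    unfolding t_def by (rule order.trans[OF degree_prod_sum_le]) (auto simp: o_def)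
  also have "\<dots> = (\<Sum>i = 0..<m. if p i = i then 1 else 0)"
    by (intro sum.cong) (auto simp: entry)
  also have "\<dots> = card ({0..<m} - ?N)"
    by (simp add: sum.If_cases Int_def set_diff_eq)
  also have "\<dots> = m - card ?N"
    using N by (simp add: card_Diff_subset finite_subset)
  finally have 1: "card ?N \<le> k"
    using k card_mono[OF _ N] by simp
  \<comment> \<open>A zero entry can occur only at a fixed point, where the factor is exactly x.
    Hence x to the power \<open>card ?Z\<close> divides \<open>t p\<close>.\<close>
  have "t p = (\<Prod>i\<in>?Z. char_poly_matrix A $$ (i, p i)) *
      (\<Prod>i\<in>{0..<m} - ?Z. char_poly_matrix A $$ (i, p i))"
    unfolding t_def by (subst prod.subset_diff[of ?Z]) (auto simp: mult.commute)
  also have "(\<Prod>i\<in>?Z. char_poly_matrix A $$ (i, p i)) = (\<Prod>i\<in>?Z. [:0, 1:])"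
  proof (intro prod.cong refl)
    fix i assume "i \<in> ?Z"
    moreover from this have "p i = i" using supp by auto
    ultimately show "char_poly_matrix A $$ (i, p i) = [:0, 1:]" using entry[of i] by simp
  qed
  also have "\<dots> = monom 1 (card ?Z)" by (simp add: monom_altdef)
  finally have "card ?Z \<le> m - k"
    using c by (auto simp: coeff_monom_mult split: if_splits)
  moreover have "card {i \<in> {0..<m}. A $$ (i, p i) \<noteq> 0} = m - card ?Z"
  proof -
    have "{i \<in> {0..<m}. A $$ (i, p i) \<noteq> 0} = {0..<m} - ?Z" by auto
    moreover have "card ({0..<m} - ?Z) = card {0..<m} - card ?Z"
      by (intro card_Diff_subset) auto
    ultimately show ?thesis by simp
  qed
  ultimately have "k \<le> card {i \<in> {0..<m}. A $$ (i, p i) \<noteq> 0}" using k by simp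
  with p 1 supp show ?thesis by (intro that) auto
qed

section \<open>Closed walks, covering and counting in sorted lists\<close>

text \<open>By injectivity the whole cycle through \<open>x\<close> consists of moved points, and
  its length is the return time.\<close>

lemma permutes_return_time:
  assumes p: "p permutes S" and S: "finite S" and x: "p x \<noteq> x"
  obtains t where "1 \<le> t" "t \<le> card {i. p i \<noteq> i}" "(p ^^ t) x = x"
proof -
  have perm: "permutation p" using p S by (auto simp: permutation_permutes)
  let ?t = "least_power p x"
  have moved: "p ((p ^^ j) x) \<noteq> (p ^^ j) x" for j
    using x bij_is_inj[OF permutation_bijective[OF perm]] by (induction j) (auto dest: injD)
  have "{i. p i \<noteq> i} \<subseteq> S" using permutes_not_in[OF p] by auto
  then have "card (set (support p x)) \<le> card {i. p i \<noteq> i}"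
    using moved S by (intro card_mono) (auto intro: finite_subset)
  moreover have "card (set (support p x)) = ?t"
    using distinct_card[OF cycle_of_permutation[OF perm]] by simp
  ultimately show ?thesis
    using least_power_of_permutation[OF perm, of x] by (intro that[of ?t]) auto
qed

lemma conv_map_mono:
  assumes "A \<subseteq> B" "A \<noteq> {}" "finite B"
  shows "conv_map f A \<subseteq> conv_map f B"
proof -
  have "f ` A \<subseteq> f ` B" "f ` A \<noteq> {}" "finite (f ` B)" using assms by auto
  then have "Min (f ` B) \<le> Min (f ` A)" "Max (f ` A) \<le> Max (f ` B)"
    by (auto intro: Min_antimono Max_mono)
  then show ?thesis by (auto simp: conv_map_def)
qed

text \<open>By monotonicity a walk in the covering relation survives in the iterates. Applied to a
  closed walk, this bounds a characteristic number by the length of the walk.\<close>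

lemma conv_map_iterate_along_path:
  assumes "\<And>j. j < t \<Longrightarrow> {e (Suc j), e (Suc j) + 1} \<subseteq> conv_map f {e j, e j + 1}"
  shows "{e t, e t + 1} \<subseteq> (conv_map f ^^ t) {e 0, e 0 + 1}"
  using assms
proof (induction t)
  case (Suc t)
  have "finite ((conv_map f ^^ t) {e 0, e 0 + 1})"
    by (cases t) (auto simp: conv_map_def)
  then have "conv_map f {e t, e t + 1} \<subseteq> conv_map f ((conv_map f ^^ t) {e 0, e 0 + 1})"
    using Suc by (intro conv_map_mono) auto
  then show ?case using Suc.prems[of t] by auto
qed simp

lemma sorted_nth_le_of_card:
  fixes xs :: "'a :: linorder list"
  assumes xs: "sorted xs" and k: "1 \<le> k" and card: "k \<le> length (filter (\<lambda>x. x \<le> b) xs)"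
  shows "xs ! (k - 1) \<le> b"
proof (rule ccontr)
  assume gt: "\<not> xs ! (k - 1) \<le> b"
  have "i < k - 1" if i: "i < length xs" "xs ! i \<le> b" for i
  proof (rule ccontr)
    assume "\<not> i < k - 1"
    then have "xs ! (k - 1) \<le> xs ! i" by (intro sorted_nth_mono[OF xs _ i(1)]) simp
    then have "xs ! (k - 1) \<le> b" using i(2) by (rule order.trans)
    with gt show False by contradiction
  qed
  then have "{i. i < length xs \<and> xs ! i \<le> b} \<subseteq> {..<k - 1}" by blast
  then have "card {i. i < length xs \<and> xs ! i \<le> b} \<le> card {..<k - 1}"
    by (intro card_mono) auto
  then show False using card k by (simp add: length_filter_conv_card)
qed

section \<open>The signed covering matrix of a cyclic permutation\<close>

lemma cyclic_permutation_invariant_set: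
  assumes f: "cyclic_permutation n f" and A: "A \<subseteq> {1..n}" "A \<noteq> {}" "f ` A \<subseteq> A"
  shows "A = {1..n}"
proof -
  obtain cs where cs: "distinct cs" "set cs = {1..n}" "f = cycle_of_list cs"
    using f by (auto simp: cyclic_permutation_def)
  obtain a where a: "a \<in> A" using A by auto
  then obtain i where i: "i < length cs" "cs ! i = a"
    using A cs by (metis in_set_conv_nth subsetD)
  have iter: "(f ^^ k) a \<in> A" for k
    using a A by (induction k) auto
  have "cs ! j \<in> A" if j: "j < length cs" for j
  proof -
    \<comment> \<open>Moving from position \<open>i\<close> to position \<open>j\<close> takes
      \<open>j - i\<close> steps modulo the length; this form avoids truncated subtraction.\<close>
    let ?k = "j + (length cs - i)"
    have "(f ^^ ?k) (cs ! i) = map (f ^^ ?k) cs ! i" using i by simp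
    also have "\<dots> = rotate ?k cs ! i" using cyclic_rotation[OF cs(1)] cs(3) by simp
    also have "\<dots> = cs ! ((?k + i) mod length cs)" using i by (simp add: nth_rotate)
    also have "(?k + i) mod length cs = j" using i j by simp
    finally show ?thesis using iter[of ?k] i by simp
  qed
  then have "set cs \<subseteq> A" by (auto simp: in_set_conv_nth)
  then show ?thesis using cs A by auto
qed

text \<open>Row \<open>a\<close> is the signed image of \<open>{a + 1, a + 2}\<close>: rows and columns are numbered from \<open>0\<close>.\<close>

definition markov_matrix :: "nat \<Rightarrow> (nat \<Rightarrow> nat) \<Rightarrow> int mat" where
  "markov_matrix m f =
     mat m m (\<lambda>(a, b). of_bool (b + 2 \<le> f (a + 2)) - of_bool (b + 2 \<le> f (a + 1)))"

text \<open>A nonzero entry means that exactly one of the two image values is at least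
  \<open>b + 2\<close>. The other is at most \<open>b + 1\<close>, so the interval between them
  contains both points.\<close>

lemma markov_matrix_nonzero_imp_covers:
  assumes "a < m" "b < m" "markov_matrix m f $$ (a, b) \<noteq> 0"
  shows "{b + 1, b + 2} \<subseteq> conv_map f {a + 1, a + 2}"
  using assms by (auto simp: markov_matrix_def conv_map_def of_bool_def split: if_splits)

text \<open>In the difference basis the permutation matrix becomes block triangular, with diagonal
  blocks \<open>1\<close> and the signed covering matrix. The block \<open>1\<close> accounts for
  the factor x - 1 of the known polynomial.\<close>

lemma char_poly_markov_matrix:
  assumes f: "cyclic_permutation (Suc m) f" and m: "m \<ge> 1"
  shows "char_poly (markov_matrix m f) = (\<Sum>i\<le>m. monom 1 i)"
proof -
  let ?n = "Suc m"
  have fp: "f permutes {1..?n}" using f by (simp add: cyclic_permutation_def)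
  have f_in: "1 \<le> f i \<and> f i \<le> ?n" if "1 \<le> i" "i \<le> ?n" for i
    using permutes_in_image[OF fp, of i] that by simp
  have f0: "f 0 = 0" using permutes_not_in[OF fp, of 0] by simp
  \<comment> \<open>This is \<open>f\<close> conjugated by \<open>Suc\<close>, because matrix
    indices start at 0.\<close>
  define h where "h i = (if i < ?n then f (i + 1) - 1 else i)" for i
  define P where "P = (mat ?n ?n (\<lambda>(i, j). if h i = j then 1 else 0) :: int mat)"
  \<comment> \<open>\<open>U\<close> passes from the basis \<open>v\<^sub>i\<close> to \<open>v\<^sub>0\<close> and the differences \<open>v\<^sub>i - v\<^bsub>i-1\<^esub>\<close>, in which \<open>P\<close> becomes \<open>B\<close>.\<close>
  define U where "U = (mat ?n ?n (\<lambda>(i, j). of_bool (i = j) - of_bool (i = j + 1)) :: int mat)"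
  \<comment> \<open>The junk value \<open>f 0 = 0\<close> makes this formula valid for row \<open>0\<close> too.\<close>
  define B where "B = (mat ?n ?n (\<lambda>(i, j). of_bool (j < f (i + 1)) - of_bool (j < f i)) :: int mat)"
  have [simp]: "P \<in> carrier_mat ?n ?n" "U \<in> carrier_mat ?n ?n" "B \<in> carrier_mat ?n ?n"
    by (auto simp: P_def U_def B_def)
  have h_lt: "h i < ?n" if "i < ?n" for i
    using f_in[of "i + 1"] that by (auto simp: h_def)
  have h: "h permutes {0..<?n}"
  proof (rule bij_imp_permutes)
    have "inj_on h {0..<?n}"
    proof
      fix x y assume "x \<in> {0..<?n}" "y \<in> {0..<?n}" "h x = h y"
      then have "f (x + 1) = f (y + 1)" using f_in[of "x + 1"] f_in[of "y + 1"] by (auto simp: h_def)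
      then show "x = y" using permutes_inj[OF fp] by (auto dest: injD)
    qed
    moreover have "h ` {0..<?n} \<subseteq> {0..<?n}" using h_lt by auto
    ultimately show "bij_betw h {0..<?n} {0..<?n}"
      by (simp add: bij_betw_def endo_inj_surj)
  qed (auto simp: h_def)
  have trans: "A = {0..<?n}" if A: "A \<subseteq> {0..<?n}" "A \<noteq> {}" "h ` A \<subseteq> A" for A
  proof -
    have "f (Suc i) \<in> Suc ` A" if "i \<in> A" for i
    proof -
      have "i < ?n" using A that by auto
      then have "f (Suc i) = Suc (h i)" using f_in[of "Suc i"] by (simp add: h_def)
      then show ?thesis using A that by auto
    qed
    then have "f ` (Suc ` A) \<subseteq> Suc ` A" by auto
    then have "Suc ` A = {1..?n}"
      using A by (intro cyclic_permutation_invariant_set[OF f]) auto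
    also have "\<dots> = Suc ` {0..<?n}"
      by (simp only: image_Suc_atLeastAtMost atLeastLessThanSuc_atLeastAtMost One_nat_def)
    finally show ?thesis by (simp only: inj_image_eq_iff[OF inj_Suc])
  qed
  obtain c where c: "char_poly P = monom 1 ?n + [:c:]"
    using char_poly_cyclic_permutation_matrix[OF h _ trans] m unfolding P_def by auto
  have "U * P = B * U"
  proof (rule eq_matI)
    fix i j assume "i < dim_row (B * U)" "j < dim_col (B * U)"
    then have i: "i < ?n" and j: "j < ?n" by (auto simp: B_def U_def)
    have "(U * P) $$ (i, j) = (\<Sum>k<?n. (of_bool (i = k) - of_bool (i = k + 1)) * of_bool (h k = j))"
      using i j by (simp add: scalar_prod_def U_def P_def atLeast0LessThan of_bool_def)
    also have "\<dots> = (\<Sum>k<?n. if k = i then of_bool (h k = j) else 0) -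
        (\<Sum>k<?n. if i = k + 1 then of_bool (h k = j) else 0)"
      by (simp only: sum_subtractf[symmetric]) (intro sum.cong, auto)
    also have "(\<Sum>k<?n. if i = k + 1 then of_bool (h k = j) else 0) =
        (of_bool (i \<ge> 1 \<and> h (i - 1) = j) :: int)"
      using i by (cases i) auto
    also have "(\<Sum>k<?n. if k = i then of_bool (h k = j) else 0) = (of_bool (h i = j) :: int)"
      using i by simp
    finally have 1: "(U * P) $$ (i, j) = of_bool (h i = j) - of_bool (i \<ge> 1 \<and> h (i - 1) = j)" .
    let ?b = "\<lambda>k. of_bool (k < f (i + 1)) - of_bool (k < f i) :: int"
    have "(B * U) $$ (i, j) = (\<Sum>k<?n. ?b k * (of_bool (k = j) - of_bool (k = j + 1)))"
      using i j by (simp add: scalar_prod_def U_def B_def atLeast0LessThan)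
    also have "\<dots> = (\<Sum>k<?n. if k = j then ?b k else 0) - (\<Sum>k<?n. if k = j + 1 then ?b k else 0)"
      by (simp only: sum_subtractf[symmetric]) (intro sum.cong, auto)
    \<comment> \<open>In the last column the index \<open>j + 1\<close> lies outside the matrix, but
      there \<open>?b (j + 1)\<close> is 0 because no value of \<open>f\<close> involved exceeds
      \<open>?n\<close>.\<close>
    also have "(\<Sum>k<?n. if k = j + 1 then ?b k else 0) = ?b (j + 1)"
    proof (cases "j + 1 < ?n")
      case True
      then show ?thesis by simp
    next
      case False
      then have "\<not> j + 1 < f (i + 1)" "\<not> j + 1 < f i"
        using f_in[of "i + 1"] f_in[of i] f0 i by (cases i; force)+
      then show ?thesis using False by auto
    qed
    also have "(\<Sum>k<?n. if k = j then ?b k else 0) = ?b j" using j by simp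
    finally have 2: "(B * U) $$ (i, j) = ?b j - ?b (j + 1)" .
    have "of_bool (k < x) - of_bool (k + 1 < x) = (of_bool (x = k + 1) :: int)" for k x :: nat
      by auto
    then have "?b j - ?b (j + 1) = of_bool (f (i + 1) = j + 1) - of_bool (f i = j + 1)"
      by (smt (verit))
    also have "(f (i + 1) = j + 1) = (h i = j)"
      using i f_in[of "i + 1"] by (auto simp: h_def)
    also have "(f i = j + 1) = (i \<ge> 1 \<and> h (i - 1) = j)"
      using i f_in[of i] f0 by (cases i) (auto simp: h_def)
    finally show "(U * P) $$ (i, j) = (B * U) $$ (i, j)" using 1 2 by simp
  qed (auto simp: P_def U_def B_def)
  moreover have "det U = prod_list (diag_mat U)"
    by (rule det_lower_triangular[of ?n]) (auto simp: U_def)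
  then have "det U \<noteq> 0"
    by (auto simp: diag_mat_def U_def prod_list_zero_iff)
  ultimately have "char_poly P = char_poly B"
    by (intro char_poly_intertwine[of _ ?n _ U]) auto
  \<comment> \<open>In each row \<open>i\<close> with \<open>i \<ge> 1\<close>, both
    \<open>f i\<close> and \<open>f (i + 1)\<close> are positive, so the entry in column 0 is 1 - 1
    = 0.\<close>
  also have "B = four_block_mat (mat 1 1 (\<lambda>_. 1)) (mat 1 m (\<lambda>(i, j). of_bool (j + 1 < f 1)))
      (0\<^sub>m m 1) (markov_matrix m f)"
  proof (rule eq_matI, goal_cases)
    case (1 i j)
    then have "i < ?n" "j < ?n" by (auto simp: markov_matrix_def)
    then show ?case using f0 f_in[of "Suc i"] f_in[of i]
      by (cases i; cases j) (auto simp: B_def markov_matrix_def Suc_le_eq)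
  qed (auto simp: B_def markov_matrix_def)
  also have "char_poly \<dots> = char_poly (mat 1 1 (\<lambda>_. 1)) * char_poly (markov_matrix m f)"
    by (rule char_poly_four_block_zeros_col) (auto simp: markov_matrix_def)
  also have "char_poly (mat 1 1 (\<lambda>_. 1) :: int mat) = [:-1, 1:]"
    by (subst char_poly_upper_triangular[of _ 1]) (auto simp: diag_mat_def)
  finally have factor: "monom 1 ?n + [:c:] = [:-1, 1:] * char_poly (markov_matrix m f)"
    using c by simp
  \<comment> \<open>Evaluating at the root 1 of the linear factor determines the constant left open
    before.\<close>
  then have "poly (monom 1 ?n + [:c:]) 1 = 0" by simp
  then have "c = -1" by (simp add: poly_monom)
  moreover have "[:-1, 1:] * (\<Sum>i\<le>m. monom 1 i) = monom 1 ?n + [:-1 :: int:]"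
    by (induction m) (auto simp: algebra_simps monom_Suc one_pCons)
  ultimately have "[:-1, 1:] * char_poly (markov_matrix m f) = [:-1, 1:] * (\<Sum>i\<le>m. monom 1 i)"
    using factor by simp
  then show ?thesis by (simp only: mult_cancel_left) simp
qed

section \<open>From closed walks to the characteristic sequence\<close>

text \<open>Here \<open>k\<close> is both a bound on walk lengths and a count of intervals: having
  \<open>k\<close> values at most \<open>k\<close> is what bounds the \<open>k\<close>-th smallest
  one.\<close>

lemma card_char_number_le:
  assumes f: "cyclic_permutation (Suc m) f" and k: "1 \<le> k" "k \<le> m"
  shows "k \<le> card {a \<in> {0..<m}. char_number f (a + 1) \<le> enat k}"
proof -
  let ?M = "markov_matrix m f"
  have "coeff (char_poly ?M) (m - k) = 1"
    using k by (simp add: char_poly_markov_matrix[OF f] coeff_sum)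
  then obtain p where p: "p permutes {0..<m}" "card {i. p i \<noteq> i} \<le> k"
      "\<And>i. p i \<noteq> i \<Longrightarrow> ?M $$ (i, p i) \<noteq> 0"
      "k \<le> card {i \<in> {0..<m}. ?M $$ (i, p i) \<noteq> 0}"
    using char_poly_coeff_nonzero_obtains_permutation[of ?M m k] k
    by (auto simp: markov_matrix_def)
  have "char_number f (a + 1) \<le> enat k" if a: "a < m" "?M $$ (a, p a) \<noteq> 0" for a
  proof -
    \<comment> \<open>A fixed point with nonzero diagonal entry is a loop of length 1; a moved point
      returns within the number of moved points.\<close>
    obtain t where t: "1 \<le> t" "t \<le> k" "(p ^^ t) a = a"
    proof (cases "p a = a")
      case True
      then show ?thesis using k by (intro that[of 1]) auto
    next
      case False
      then show ?thesis using permutes_return_time[OF p(1) _ False] p(2) that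
        by (metis finite_atLeastLessThan le_trans)
    qed
    have lt: "(p ^^ j) a < m" for j
      using a permutes_in_image[OF p(1)] by (induction j) auto
    \<comment> \<open>Each point of the walk is either moved, so that \<open>p(3)\<close> applies,
      or equal to \<open>a\<close>, so that \<open>a(2)\<close> applies.\<close>
    have "p ((p ^^ j) a) \<noteq> (p ^^ j) a \<or> (p ^^ j) a = a" for j
      using permutes_inj[OF p(1)] by (induction j) (auto simp: inj_eq)
    then have "?M $$ ((p ^^ j) a, p ((p ^^ j) a)) \<noteq> 0" for j
      using a(2) p(3)[of "(p ^^ j) a"] by (cases "(p ^^ j) a = a") auto
    then have "{(p ^^ Suc j) a + 1, (p ^^ Suc j) a + 2} \<subseteq> conv_map f {(p ^^ j) a + 1, (p ^^ j) a + 2}"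
      for j
      using markov_matrix_nonzero_imp_covers[of "(p ^^ j) a" m "(p ^^ Suc j) a" f]
        lt[of j] lt[of "Suc j"] by simp
    then have "{a + 1, a + 1 + 1} \<subseteq> (conv_map f ^^ t) {a + 1, a + 1 + 1}"
      using conv_map_iterate_along_path[of t "\<lambda>j. (p ^^ j) a + 1" f] t by simp
    then have "char_number f (a + 1) \<le> enat t"
      unfolding char_number_def using t by (intro Inf_lower) auto
    then show ?thesis using t by (meson enat_ord_simps(1) order.trans)
  qed
  then have "card {i \<in> {0..<m}. ?M $$ (i, p i) \<noteq> 0} \<le>
      card {a \<in> {0..<m}. char_number f (a + 1) \<le> enat k}"
    by (intro card_mono) auto
  with p(4) show ?thesis by simp
qed

theorem lemma1p6:
  fixes n :: nat and f :: "nat \<Rightarrow> nat"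
  assumes "n \<ge> 2"
    and "cyclic_permutation n f"
  shows "\<forall>i \<in> {1..n - 1}. char_sequence n f ! (i - 1) \<le> enat i"
proof
  fix k assume k: "k \<in> {1..n - 1}"
  obtain m where n: "n = Suc m" using assms(1) by (cases n) auto
  have "k \<le> card {a \<in> {0..<m}. char_number f (a + 1) \<le> enat k}"
    using card_char_number_le[of m f k] assms(2) k n by simp
  \<comment> \<open>The interval starting at \<open>a + 1\<close> has list position
    \<open>a\<close>, so both index sets agree.\<close>
  also have "{a \<in> {0..<m}. char_number f (a + 1) \<le> enat k} =
      {i. i < length [1..<n] \<and> map (char_number f) [1..<n] ! i \<le> enat k}"
    by (auto simp: n simp del: upt_Suc)
  also have "card \<dots> = length (filter (\<lambda>x. x \<le> enat k) (map (char_number f) [1..<n]))"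
    by (simp add: length_filter_conv_card)
  also have "\<dots> = length (filter (\<lambda>x. x \<le> enat k) (char_sequence n f))"
    unfolding char_sequence_def by (metis filter_sort length_sort)
  finally show "char_sequence n f ! (k - 1) \<le> enat k"
    using k by (intro sorted_nth_le_of_card) (auto simp: char_sequence_def)
qed

end
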